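(* Let $w$ be a nontrivial lower Christoffel word on $\{a,b\}$. Then $L(B(w))=L(E(w^* )^*\,|\,E(w))$.
   Context: Digits and norms: $\mathscr{Q}=\{(x,y): x^2+y^2=1,\ x,y\ge0\}$, Romik's map $\mathcal{T}(x,y)=\left(\frac{|2-x-2y|}{3-2x-2y},\frac{|2-2x-y|}{3-2x-2y}\right)$, digit of $(x,y)$ equal to $1$ if $4/5\le x\le1$, $2$ if $3/5\le x\le4/5$, $3$ if $0\le x\le3/5$ (boundary points admit both adjacent digits). Every $P\in\{1,2,3\}^{\mathbb{N}}$ is the digit expansion of exactly one point $(\alpha,\beta)\in\mathscr{Q}$, and $\|P\|=\frac{1+\beta-\alpha}{\sqrt2\,\alpha}\in[0,\infty]$. Words: for a word $W$ on $\{a,b,a^\vee\}$ (finite or infinite), $W^*$ is its reverse and $W^\vee$ is obtained by exchanging the letters $a$ and $a^\vee$ (with $b$ fixed). For a finite word $w$ on $\{a,b\}$, $w^*$ is its reverse and $w^\infty=www\cdots$. For a finite or right-infinite word $E=l_1l_2\cdots$ on $\{a,b\}$, $\jmath(E)=l_1'l_2'\cdots$ where $l_k'=b$ if $l_k=b$, and if $l_k=a$ then $l_k'=a$ or $a^\vee$ according as the number of $b$'s among $l_1,\dots,l_{k-1}$ is even or odd. Put $E(w)=\jmath(w^\infty)$. $\Pi$ is the substitution $a\mapsto 31$, $b\mapsto2$, $a^\vee\mapsto13$ from right-infinite words on $\{a,b,a^\vee\}$ to $\{1,2,3\}^{\mathbb{N}}$. A doubly infinite word is an element of $\{a,b,a^\vee\}^{\mathbb{Z}}$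 up to shift; a section $E^*|F$ ($E=e_1e_2\cdots$, $F=f_1f_2\cdots$) is a choice of base point so that it reads $\cdots e_2e_1f_1f_2\cdots$. $B(w)$ is the doubly infinite word having the section $E(w^* )^*|E(w)$. For a section, $L(E^*|F)=(\|\Pi(E^\vee)\|+\|\Pi(F)\|)/\sqrt2$, and for a doubly infinite word $B$, $L(B)=\sup\max\{L(E^*|F),L((E^\vee)^*|F^\vee)\}$ over all sections $E^*|F$ of $B$. Christoffel words: for coprime positive integers $s,t$, the lower (resp. upper) Christoffel word of slope $t/s$ encodes the lattice path from $(0,0)$ to $(s,t)$ using unit horizontal steps (letter $a$) and unit vertical steps (letter $b$) that lies below (resp. above) the segment from $(0,0)$ to $(s,t)$ such that no lattice point lies strictly between the path and the segment. The words $a$ and $b$ are the trivial Christoffel words (slopes $0$ and $\infty$); nontrivial ones have length at least $2$. *)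

theory Defs
  imports "HOL-Library.Stream" "HOL-Library.Extended_Real"
begin

section \<open>Romik's dynamical system on the quarter circle\<close>

definition quarter_circle :: "(real \<times> real) set" where
  "quarter_circle = {(x, y). x\<^sup>2 + y\<^sup>2 = 1 \<and> 0 \<le> x \<and> 0 \<le> y}"

definition romik :: "real \<times> real \<Rightarrow> real \<times> real" where
  "romik = (\<lambda>(x, y). (\<bar>2 - x - 2 * y\<bar> / (3 - 2 * x - 2 * y),
                      \<bar>2 - 2 * x - y\<bar> / (3 - 2 * x - 2 * y)))"

text \<open>A relation rather than a function, because the points with \<open>x = 3/5\<close> or \<open>x = 4/5\<close>
  admit both adjacent digits.\<close>

definition has_digit :: "real \<times> real \<Rightarrow> nat \<Rightarrow> bool" where
  "has_digit p d \<longleftrightarrow>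
     (d = 1 \<and> 4/5 \<le> fst p \<and> fst p \<le> 1) \<or>
     (d = 2 \<and> 3/5 \<le> fst p \<and> fst p \<le> 4/5) \<or>
     (d = 3 \<and> 0 \<le> fst p \<and> fst p \<le> 3/5)"

definition digit_expansion :: "nat stream \<Rightarrow> real \<times> real \<Rightarrow> bool" where
  "digit_expansion P p \<longleftrightarrow> p \<in> quarter_circle \<and> (\<forall>n. has_digit ((romik ^^ n) p) (P !! n))"

text \<open>Every stream with values in \<open>{1, 2, 3}\<close> is the digit expansion of exactly one point, so the
  description is proper for such streams.\<close>

definition expansion_point :: "nat stream \<Rightarrow> real \<times> real" where
  "expansion_point P = (THE p. digit_expansion P p)"

text \<open>The quotient is taken in \<^typ>\<open>ereal\<close>, so it is \<open>\<infinity>\<close> at the point \<open>(0, 1)\<close>.\<close>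

definition digit_norm :: "nat stream \<Rightarrow> ereal" where
  "digit_norm P = (case expansion_point P of
     (\<alpha>, \<beta>) \<Rightarrow> ereal (1 + \<beta> - \<alpha>) / ereal (sqrt 2 * \<alpha>))"


section \<open>Words\<close>

text \<open>\<open>La\<close>, \<open>Lb\<close>, \<open>Lav\<close> stand for \<open>a\<close>, \<open>b\<close>, \<open>a\<^sup>\<or>\<close>. Words on \<open>{a, b}\<close> are words on this alphabet
  in which \<open>Lav\<close> does not occur.\<close>

datatype letter = La | Lb | Lav

fun vee_letter :: "letter \<Rightarrow> letter" where
  "vee_letter La = Lav"
| "vee_letter Lb = Lb"
| "vee_letter Lav = La"

definition vee :: "letter stream \<Rightarrow> letter stream" where
  "vee = smap vee_letter"

text \<open>Only meant for streams on \<open>{a, b}\<close>; \<open>stake k E\<close> consists of the letters preceding the one at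
  (zero-based) position \<open>k\<close>.\<close>

definition jmath :: "letter stream \<Rightarrow> letter stream" where
  "jmath E = smap (\<lambda>k. if E !! k = La \<and> odd (count_list (stake k E) Lb) then Lav else E !! k) nats"

definition Eword :: "letter list \<Rightarrow> letter stream" where
  "Eword w = jmath (cycle w)"

fun Pi_letter :: "letter \<Rightarrow> nat list" where
  "Pi_letter La = [3, 1]"
| "Pi_letter Lb = [2]"
| "Pi_letter Lav = [1, 3]"

definition Pi_subst :: "letter stream \<Rightarrow> nat stream" where
  "Pi_subst E = flat (smap Pi_letter E)"


section \<open>Doubly infinite words and their sections\<close>

definition shift_equiv :: "(int \<Rightarrow> letter) \<Rightarrow> (int \<Rightarrow> letter) \<Rightarrow> bool" where
  "shift_equiv u v \<longleftrightarrow> (\<exists>n. \<forall>i. v i = u (i + n))"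

quotient_type biword = "int \<Rightarrow> letter" / shift_equiv
proof (rule equivpI)
  show "reflp shift_equiv"
    unfolding reflp_def shift_equiv_def by (auto intro: exI[of _ 0])
  show "symp shift_equiv"
  proof (rule sympI)
    fix u v assume "shift_equiv u v"
    then obtain n where n: "\<And>i. v i = u (i + n)"
      unfolding shift_equiv_def by blast
    have "u i = v (i + - n)" for i
      by (simp add: n)
    then show "shift_equiv v u"
      unfolding shift_equiv_def by blast
  qed
  show "transp shift_equiv"
  proof (rule transpI)
    fix u v x assume "shift_equiv u v" "shift_equiv v x"
    then obtain n m where n: "\<And>i. v i = u (i + n)" and m: "\<And>i. x i = v (i + m)"
      unfolding shift_equiv_def by blast
    have "x i = u (i + (m + n))" for i
      by (simp add: n m add.assoc)
    then show "shift_equiv u x"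
      unfolding shift_equiv_def by blast
  qed
qed

text \<open>A section \<open>E\<^sup>*|F\<close> is represented by the pair of right-infinite words \<open>E\<close>, \<open>F\<close>: the word
  \<open>\<dots> e\<^sub>2 e\<^sub>1 f\<^sub>1 f\<^sub>2 \<dots>\<close> has \<open>f\<^sub>1\<close> at position \<open>0\<close> and \<open>e\<^sub>1\<close> at position \<open>-1\<close>.\<close>

definition glue :: "letter stream \<Rightarrow> letter stream \<Rightarrow> int \<Rightarrow> letter" where
  "glue E F i = (if 0 \<le> i then F !! nat i else E !! nat (- i - 1))"

definition biword_of_section :: "letter stream \<Rightarrow> letter stream \<Rightarrow> biword" where
  "biword_of_section E F = abs_biword (glue E F)"

definition sections :: "biword \<Rightarrow> (letter stream \<times> letter stream) set" where
  "sections B = {(E, F). biword_of_section E F = B}"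

text \<open>\<open>L_section E F\<close> is \<open>L(E\<^sup>*|F)\<close>.\<close>

definition L_section :: "letter stream \<Rightarrow> letter stream \<Rightarrow> ereal" where
  "L_section E F = (digit_norm (Pi_subst (vee E)) + digit_norm (Pi_subst F)) / ereal (sqrt 2)"

definition L_biword :: "biword \<Rightarrow> ereal" where
  "L_biword B = (SUP (E, F) \<in> sections B. max (L_section E F) (L_section (vee E) (vee F)))"

definition Bword :: "letter list \<Rightarrow> biword" where
  "Bword w = biword_of_section (Eword (rev w)) (Eword w)"


section \<open>Lower Christoffel words\<close>

text \<open>The lattice points visited by the path from the origin encoded by \<open>w\<close>, with \<open>a\<close> a horizontal
  and \<open>b\<close> a vertical unit step.\<close>

definition path_points :: "letter list \<Rightarrow> (nat \<times> nat) set" where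
  "path_points w = {(count_list (take k w) La, count_list (take k w) Lb) | k. k \<le> length w}"

text \<open>The last two conditions say that the path stays weakly below the segment from \<open>(0, 0)\<close> to
  \<open>(s, t)\<close>, i.e. below the line \<open>y = (t/s) x\<close>, and that no lattice point \<open>(x, y)\<close> in the range of
  the segment lies strictly below the segment and strictly above the path. For \<open>0 \<le> x \<le> s\<close> the
  path meets the vertical line through \<open>(x, 0)\<close> in an interval between two lattice points, so it
  suffices to compare with the lattice points of the path.\<close>

definition lower_christoffel_of_slope :: "nat \<Rightarrow> nat \<Rightarrow> letter list \<Rightarrow> bool" where
  "lower_christoffel_of_slope s t w \<longleftrightarrow>
     set w \<subseteq> {La, Lb} \<and> count_list w La = s \<and> count_list w Lb = t \<and>
     (\<forall>(x, y) \<in> path_points w. s * y \<le> t * x) \<and>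
     \<not> (\<exists>x y. x \<le> s \<and> s * y < t * x \<and> (\<forall>y'. (x, y') \<in> path_points w \<longrightarrow> y' < y))"

definition trivial_christoffel :: "letter list \<Rightarrow> bool" where
  "trivial_christoffel w \<longleftrightarrow> w = [La] \<or> w = [Lb]"

definition lower_christoffel :: "letter list \<Rightarrow> bool" where
  "lower_christoffel w \<longleftrightarrow>
     trivial_christoffel w \<or>
     (\<exists>s t. 0 < s \<and> 0 < t \<and> coprime s t \<and> lower_christoffel_of_slope s t w)"

end

(* The coordinate (1 + y - x) / (sqrt 2 * x) of the quarter circle turns the inverse branches of
   Romik's map into Moebius maps, and the maps attached to the letters a, b and the dual of a are
   uniform contractions of [1/3, 3]; so the norm of a substituted word is the limit of a continued
   fraction (val). The vee operation inverts it, and on words produced by jmath it is monotone for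
   the lexicographic order in which a exceeds b. A section of B(w) is, up to a simultaneous vee, cut
   out of the periodic word generated by w. As w codes the line of slope t/s from below, the forward
   word of w has the fewest letters b in every prefix and the backward one the most, among all
   forward and backward words. Hence both summands of L are maximal at the distinguished section,
   also against the dual sections. *)

theory Submission
  imports Defs
begin

section \<open>Inverse branches of Romik's map\<close>

text \<open>Inverse of the coordinate (1 + y - x) / (sqrt 2 * x) that \<open>digit_norm\<close>
  evaluates; the range [0, \<infinity>) parametrizes the quarter circle without the point (0,
  1).\<close>

definition circle_point :: "real \<Rightarrow> real \<times> real" where
  "circle_point \<xi> = ((1 + sqrt 2 * \<xi>) / (1 + sqrt 2 * \<xi> + \<xi>\<^sup>2),
                     \<xi> * (sqrt 2 + \<xi>) / (1 + sqrt 2 * \<xi> + \<xi>\<^sup>2))"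

text \<open>The inverse branches of Romik's map in this coordinate. Digits 1, 2, 3 send [0,
  \<infinity>) into [0, 1 / sqrt 2], [1 / sqrt 2, sqrt 2] and [sqrt 2, \<infinity>).\<close>

definition branch :: "nat \<Rightarrow> real \<Rightarrow> real" where
  "branch d \<xi> = (if d = 1 then \<xi> / (1 + sqrt 2 * \<xi>)
                else if d = 2 then (\<xi> + sqrt 2) / (1 + sqrt 2 * \<xi>)
                else \<xi> + sqrt 2)"

lemma circle_point_denom_pos: "0 \<le> \<xi> \<Longrightarrow> 0 < 1 + sqrt 2 * \<xi> + \<xi>\<^sup>2"
  by (simp add: add_pos_nonneg)

lemma circle_point_in_quarter_circle:
  assumes "0 \<le> \<xi>" shows "circle_point \<xi> \<in> quarter_circle"
proof -
  let ?D = "1 + sqrt 2 * \<xi> + \<xi>\<^sup>2"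
  have D: "?D > 0" using assms by (rule circle_point_denom_pos)
  \<comment> \<open>Replacing sqrt 2 by a variable \<open>r\<close> with
    \<open>r\<^sup>2 - 2 = 0\<close> leaves a polynomial identity for
    \<open>algebra\<close>.\<close>
  obtain r :: real where r: "sqrt 2 = r" and s: "r\<^sup>2 - 2 = 0"
    using real_sqrt_pow2[of 2] by simp
  have "(1 + sqrt 2 * \<xi>)\<^sup>2 + (\<xi> * (sqrt 2 + \<xi>))\<^sup>2 = ?D\<^sup>2"
    using s unfolding r by algebra
  then have "((1 + sqrt 2 * \<xi>) / ?D)\<^sup>2 + (\<xi> * (sqrt 2 + \<xi>) / ?D)\<^sup>2 = 1"
    using D by (simp add: power_divide add_divide_distrib[symmetric])
  then show ?thesis
    using assms D by (simp add: circle_point_def quarter_circle_def)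
qed

lemma quarter_circle_eq_circle_point:
  assumes "p \<in> quarter_circle" "0 < fst p"
  obtains \<xi> where "0 \<le> \<xi>" "p = circle_point \<xi>"
proof -
  obtain x y where p: "p = (x, y)" by force
  have xy: "x\<^sup>2 + y\<^sup>2 = 1" "0 < x" "0 \<le> y" using assms by (auto simp: p quarter_circle_def)
  define \<xi> where "\<xi> = (1 + y - x) / (sqrt 2 * x)"
  have "x\<^sup>2 \<le> 1" using xy(1) by (smt (verit) zero_le_power2)
  then have "x \<le> 1" using xy(2) by (simp add: power_le_one_iff abs_square_le_1)
  then have \<xi>: "0 \<le> \<xi>" using xy by (simp add: \<xi>_def)
  have a: "\<xi> * (sqrt 2 * x) = 1 + y - x" using xy by (simp add: \<xi>_def)
  let ?D = "1 + sqrt 2 * \<xi> + \<xi>\<^sup>2"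
  have D: "?D > 0" using \<xi> by (rule circle_point_denom_pos)
  have N: "1 + sqrt 2 * \<xi> = (1 + y) / x"
    using a xy by (simp add: field_simps)
  have Q: "\<xi>\<^sup>2 = (1 + y - x)\<^sup>2 / (2 * x\<^sup>2)"
    by (simp add: \<xi>_def power_divide power_mult_distrib)
  \<comment> \<open>On the circle the denominator collapses to a monomial multiple of 1 + y, from
    which both coordinates can be read off.\<close>
  have D': "?D = (1 + y) / x\<^sup>2"
  proof -
    have "(1 + y) / x = 2 * x * (1 + y) / (2 * x\<^sup>2)"
      using xy by (simp add: power2_eq_square)
    then have "?D = (2 * x * (1 + y) + (1 + y - x)\<^sup>2) / (2 * x\<^sup>2)"
      unfolding N Q by (simp add: add_divide_distrib)
    moreover have "2 * x * (1 + y) + (1 + y - x)\<^sup>2 = 2 * (1 + y)"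
      using xy(1) by algebra
    ultimately show ?thesis by (metis mult_divide_mult_cancel_left zero_neq_numeral)
  qed
  have X: "(1 + sqrt 2 * \<xi>) / ?D = x"
    unfolding D' unfolding N using xy by (simp add: power2_eq_square)
  have "\<xi> * (sqrt 2 + \<xi>) = ?D - 1" by (simp add: power2_eq_square algebra_simps)
  then have "\<xi> * (sqrt 2 + \<xi>) / ?D = 1 - 1 / ?D" using D by (simp only: diff_divide_distrib) simp
  also have "\<dots> = 1 - x\<^sup>2 / (1 + y)" by (simp add: D')
  also have "\<dots> = y" using xy by (simp add: field_simps power2_eq_square)
  finally show ?thesis using that \<xi> X by (simp add: circle_point_def p)
qed

text \<open>Turns the norm of a stream whose point is \<open>circle_point \<xi>\<close> into
  \<open>\<xi>\<close>, and makes \<open>circle_point\<close> injective.\<close>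

lemma circle_point_inverse:
  assumes "0 \<le> \<xi>"
  shows "(1 + snd (circle_point \<xi>) - fst (circle_point \<xi>)) / (sqrt 2 * fst (circle_point \<xi>)) = \<xi>"
proof -
  let ?D = "1 + sqrt 2 * \<xi> + \<xi>\<^sup>2"
  have D: "?D > 0" using assms by (rule circle_point_denom_pos)
  have N: "1 + sqrt 2 * \<xi> > 0" using assms by (simp add: add_pos_nonneg)
  obtain r :: real where r: "sqrt 2 = r" and s: "r\<^sup>2 - 2 = 0"
    using real_sqrt_pow2[of 2] by simp
  have 1: "1 + snd (circle_point \<xi>) - fst (circle_point \<xi>) =
     (?D + \<xi> * (sqrt 2 + \<xi>) - (1 + sqrt 2 * \<xi>)) / ?D"
    unfolding circle_point_def fst_conv snd_conv diff_divide_distrib add_divide_distrib[of ?D]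
    using D by simp
  have 2: "?D + \<xi> * (sqrt 2 + \<xi>) - (1 + sqrt 2 * \<xi>) = \<xi> * (sqrt 2 * (1 + sqrt 2 * \<xi>))"
    using s unfolding r by algebra
  show ?thesis
    unfolding 1 2 using D N by (simp add: circle_point_def)
qed

lemma fst_circle_point_pos: "0 \<le> \<xi> \<Longrightarrow> 0 < fst (circle_point \<xi>)"
  by (simp add: circle_point_def circle_point_denom_pos add_pos_nonneg)

lemma circle_point_inj:
  "\<lbrakk>circle_point \<xi> = circle_point \<eta>; 0 \<le> \<xi>; 0 \<le> \<eta>\<rbrakk> \<Longrightarrow> \<xi> = \<eta>"
  by (metis circle_point_inverse)

lemma branch_nonneg: "0 \<le> \<xi> \<Longrightarrow> 0 \<le> branch d \<xi>"
  by (simp add: branch_def)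

section \<open>Romik's map on the circle and on the points of a given digit\<close>

lemma romik_denom_pos:
  fixes x y :: real
  assumes "x\<^sup>2 + y\<^sup>2 = 1"
  shows "0 < 3 - 2 * x - 2 * y"
proof (rule ccontr)
  assume "\<not> 0 < 3 - 2 * x - 2 * y"
  \<comment> \<open>Contradicts Cauchy-Schwarz: on the circle (x + y)^2 is at most 2, which is less
    than 9/4.\<close>
  then have "(3/2)\<^sup>2 \<le> (x + y)\<^sup>2" by (intro power_mono) auto
  moreover have "(x + y)\<^sup>2 + (x - y)\<^sup>2 = 2" using assms by algebra
  moreover have "0 \<le> (x - y)\<^sup>2" by simp
  ultimately show False by (simp add: power_divide)
qed

lemma romik_in_quarter_circle:
  assumes "p \<in> quarter_circle" shows "romik p \<in> quarter_circle"
proof -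
  obtain x y where p: "p = (x, y)" by force
  have xy: "x\<^sup>2 + y\<^sup>2 = 1" using assms by (auto simp: p quarter_circle_def)
  have D: "0 < 3 - 2 * x - 2 * y" using xy by (rule romik_denom_pos)
  have "(2 - x - 2 * y)\<^sup>2 + (2 - 2 * x - y)\<^sup>2 = (3 - 2 * x - 2 * y)\<^sup>2"
    using xy by algebra
  then show ?thesis
    using D by (simp add: p romik_def quarter_circle_def power_divide add_divide_distrib[symmetric])
qed

lemma quarter_circle_signs:
  fixes x y :: real
  assumes "x\<^sup>2 + y\<^sup>2 = 1" "0 \<le> x" "0 \<le> y"
  shows "4/5 \<le> x \<Longrightarrow> 0 \<le> 2 - x - 2 * y" "x \<le> 4/5 \<Longrightarrow> 2 - x - 2 * y \<le> 0"
        "3/5 \<le> x \<Longrightarrow> 2 - 2 * x - y \<le> 0" "x \<le> 3/5 \<Longrightarrow> 0 \<le> 2 - 2 * x - y"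
proof -
  have x1: "x \<le> 1" using assms by (smt (verit) power2_le_imp_le one_power2 zero_le_power2)
  have y1: "y \<le> 1" using assms by (smt (verit) power2_le_imp_le one_power2 zero_le_power2)
  have e1: "(2 - x)\<^sup>2 - (2 * y)\<^sup>2 = x * (5 * x - 4)" using assms by algebra
  have e2: "(2 - 2 * x)\<^sup>2 - y\<^sup>2 = (1 - x) * (3 - 5 * x)" using assms by algebra
  show "0 \<le> 2 - x - 2 * y" if "4/5 \<le> x"
  proof -
    have "0 \<le> x * (5 * x - 4)" using that by simp
    then have "(2 * y)\<^sup>2 \<le> (2 - x)\<^sup>2" using e1 by simp
    then have "2 * y \<le> 2 - x" by (rule power2_le_imp_le) (use x1 in simp)
    then show ?thesis by simp
  qed
  show "2 - x - 2 * y \<le> 0" if "x \<le> 4/5"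
  proof -
    have "x * (5 * x - 4) \<le> 0" using that assms by (simp add: mult_nonneg_nonpos)
    then have "(2 - x)\<^sup>2 \<le> (2 * y)\<^sup>2" using e1 by simp
    then have "2 - x \<le> 2 * y" by (rule power2_le_imp_le) (use assms in simp)
    then show ?thesis by simp
  qed
  show "2 - 2 * x - y \<le> 0" if "3/5 \<le> x"
  proof -
    have "(1 - x) * (3 - 5 * x) \<le> 0" using that x1 by (simp add: mult_nonneg_nonpos)
    then have "(2 - 2 * x)\<^sup>2 \<le> y\<^sup>2" using e2 by simp
    then have "2 - 2 * x \<le> y" by (rule power2_le_imp_le) (use assms in simp)
    then show ?thesis by simp
  qed
  show "0 \<le> 2 - 2 * x - y" if "x \<le> 3/5"
  proof -
    have "0 \<le> (1 - x) * (3 - 5 * x)" using that x1 by simp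
    then have "y\<^sup>2 \<le> (2 - 2 * x)\<^sup>2" using e2 by simp
    then have "y \<le> 2 - 2 * x" by (rule power2_le_imp_le) (use x1 in simp)
    then show ?thesis by simp
  qed
qed

text \<open>The signs with which the two absolute values in \<open>romik\<close> resolve at points
  of digit \<open>d\<close>.\<close>

definition branch_sign :: "nat \<Rightarrow> real \<times> real" where
  "branch_sign d = (if d = 1 then (1, -1) else if d = 2 then (-1, -1) else (-1, 1))"

lemma romik_on_digit:
  assumes "p \<in> quarter_circle" "has_digit p d"
  shows "romik p = (fst (branch_sign d) * (2 - fst p - 2 * snd p) / (3 - 2 * fst p - 2 * snd p),
                    snd (branch_sign d) * (2 - 2 * fst p - snd p) / (3 - 2 * fst p - 2 * snd p))"
proof -
  obtain x y where p: "p = (x, y)" by force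
  have xy: "x\<^sup>2 + y\<^sup>2 = 1" "0 \<le> x" "0 \<le> y" using assms by (auto simp: p quarter_circle_def)
  show ?thesis
    using assms(2) quarter_circle_signs[OF xy]
    by (auto simp: p romik_def has_digit_def branch_sign_def abs_if)
qed

text \<open>Without the absolute values, Romik's map is an involution of the circle.\<close>

lemma romik_inj_on_digit:
  assumes p: "p \<in> quarter_circle" "has_digit p d" and q: "q \<in> quarter_circle" "has_digit q d"
    and eq: "romik p = romik q"
  shows "p = q"
proof -
  obtain x y where xy: "p = (x, y)" by force
  obtain x' y' where xy': "q = (x', y')" by force
  define D where "D = 3 - 2 * x - 2 * y"
  define D' where "D' = 3 - 2 * x' - 2 * y'"
  have D: "D > 0" "D' > 0" using p q romik_denom_pos
    by (auto simp: D_def D'_def xy xy' quarter_circle_def)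
  have u: "(2 - x - 2 * y) / D = (2 - x' - 2 * y') / D'"
    and v: "(2 - 2 * x - y) / D = (2 - 2 * x' - y') / D'"
    using eq unfolding romik_on_digit[OF p] romik_on_digit[OF q]
    by (auto simp: xy xy' D_def[symmetric] D'_def[symmetric] branch_sign_def minus_divide_left[symmetric]
        simp del: minus_diff_eq split: if_splits)
  \<comment> \<open>The denominator can be recovered from the signed image, so equal images force
    equal denominators.\<close>
  have "1 / D = 3 - 2 * ((2 - x - 2 * y) / D) - 2 * ((2 - 2 * x - y) / D)"
    using D by (simp add: divide_simps) (simp add: D_def)
  moreover have "1 / D' = 3 - 2 * ((2 - x' - 2 * y') / D') - 2 * ((2 - 2 * x' - y') / D')"
    using D by (simp add: divide_simps) (simp add: D'_def)
  ultimately have "1 / D = 1 / D'" by (simp only: u v)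
  then have "D = D'" by simp
  then have "2 - x - 2 * y = 2 - x' - 2 * y'" "2 - 2 * x - y = 2 - 2 * x' - y'"
    using u v D by auto
  then show ?thesis by (simp add: xy xy')
qed

text \<open>Comparing with 4/5 or 3/5 gives a quadratic in \<xi> that splits into two linear
  factors, one of them positive on [0, \<infinity>). The other vanishes at 1 / sqrt 2, respectively
  sqrt 2.\<close>

lemma fst_circle_point_le_iff:
  assumes "0 \<le> \<xi>"
  shows "4/5 \<le> fst (circle_point \<xi>) \<longleftrightarrow> sqrt 2 * \<xi> \<le> 1"
    and "3/5 \<le> fst (circle_point \<xi>) \<longleftrightarrow> \<xi> \<le> sqrt 2"
    and "fst (circle_point \<xi>) \<le> 4/5 \<longleftrightarrow> 1 \<le> sqrt 2 * \<xi>"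
    and "fst (circle_point \<xi>) \<le> 3/5 \<longleftrightarrow> sqrt 2 \<le> \<xi>"
proof -
  have D: "0 < 1 + sqrt 2 * \<xi> + \<xi>\<^sup>2" using assms by (rule circle_point_denom_pos)
  obtain r :: real where r: "sqrt 2 = r" and s: "r\<^sup>2 - 2 = 0"
    using real_sqrt_pow2[of 2] by simp
  have "2 * (5 * (1 + sqrt 2 * \<xi>) - 4 * (1 + sqrt 2 * \<xi> + \<xi>\<^sup>2)) = 2 * ((1 - sqrt 2 * \<xi>) * (1 + 2 * sqrt 2 * \<xi>))"
    using s unfolding r by algebra
  then have 1: "5 * (1 + sqrt 2 * \<xi>) - 4 * (1 + sqrt 2 * \<xi> + \<xi>\<^sup>2) = (1 - sqrt 2 * \<xi>) * (1 + 2 * sqrt 2 * \<xi>)"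
    by simp
  have "sqrt 2 * (5 * (1 + sqrt 2 * \<xi>) - 3 * (1 + sqrt 2 * \<xi> + \<xi>\<^sup>2)) = sqrt 2 * ((sqrt 2 - \<xi>) * (3 * \<xi> + sqrt 2))"
    using s unfolding r by algebra
  then have 2: "5 * (1 + sqrt 2 * \<xi>) - 3 * (1 + sqrt 2 * \<xi> + \<xi>\<^sup>2) = (sqrt 2 - \<xi>) * (3 * \<xi> + sqrt 2)"
    by simp
  have p: "0 < 1 + 2 * sqrt 2 * \<xi>" "0 < 3 * \<xi> + sqrt 2" using assms by (simp_all add: add_pos_nonneg add_nonneg_pos)
  have "4/5 \<le> fst (circle_point \<xi>) \<longleftrightarrow> 0 \<le> (1 - sqrt 2 * \<xi>) * (1 + 2 * sqrt 2 * \<xi>)"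
    unfolding 1[symmetric] using D by (simp add: circle_point_def pos_le_divide_eq algebra_simps)
  then show "4/5 \<le> fst (circle_point \<xi>) \<longleftrightarrow> sqrt 2 * \<xi> \<le> 1" using p by (simp add: zero_le_mult_iff)
  have "fst (circle_point \<xi>) \<le> 4/5 \<longleftrightarrow> (1 - sqrt 2 * \<xi>) * (1 + 2 * sqrt 2 * \<xi>) \<le> 0"
    unfolding 1[symmetric] using D by (simp add: circle_point_def pos_divide_le_eq algebra_simps)
  then show "fst (circle_point \<xi>) \<le> 4/5 \<longleftrightarrow> 1 \<le> sqrt 2 * \<xi>" using p by (simp add: mult_le_0_iff)
  have "3/5 \<le> fst (circle_point \<xi>) \<longleftrightarrow> 0 \<le> (sqrt 2 - \<xi>) * (3 * \<xi> + sqrt 2)"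
    unfolding 2[symmetric] using D by (simp add: circle_point_def pos_le_divide_eq algebra_simps)
  then show "3/5 \<le> fst (circle_point \<xi>) \<longleftrightarrow> \<xi> \<le> sqrt 2" using p by (simp add: zero_le_mult_iff)
  have "fst (circle_point \<xi>) \<le> 3/5 \<longleftrightarrow> (sqrt 2 - \<xi>) * (3 * \<xi> + sqrt 2) \<le> 0"
    unfolding 2[symmetric] using D by (simp add: circle_point_def pos_divide_le_eq algebra_simps)
  then show "fst (circle_point \<xi>) \<le> 3/5 \<longleftrightarrow> sqrt 2 \<le> \<xi>" using p by (simp add: mult_le_0_iff)
qed

lemma has_digit_branch:
  assumes "0 \<le> \<xi>" "d \<in> {1, 2, 3}"
  shows "has_digit (circle_point (branch d \<xi>)) d"
proof -
  have N: "0 < 1 + sqrt 2 * \<xi>" using assms by (simp add: add_pos_nonneg)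
  note b = branch_nonneg[OF assms(1), of d]
  note iffs = fst_circle_point_le_iff[OF b]
  have nn: "0 \<le> fst (circle_point (branch d \<xi>))" "fst (circle_point (branch d \<xi>)) \<le> 1"
    using fst_circle_point_pos[OF b] circle_point_denom_pos[OF b]
    by (auto simp: circle_point_def)
  consider "d = 1" | "d = 2" | "d = 3" using assms by auto
  then show ?thesis
  proof cases
    case 1
    have "sqrt 2 * branch d \<xi> \<le> 1" using N by (simp add: 1 branch_def)
    then show ?thesis using 1 nn iffs by (simp add: has_digit_def)
  next
    case 2
    have "1 \<le> sqrt 2 * branch d \<xi>" "branch d \<xi> \<le> sqrt 2"
      using N assms by (simp_all add: 2 branch_def field_simps)
    then show ?thesis using 2 nn iffs by (simp add: has_digit_def)
  next
    case 3
    have "sqrt 2 \<le> branch d \<xi>" using assms by (simp add: 3 branch_def)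
    then show ?thesis using 3 nn iffs by (simp add: has_digit_def)
  qed
qed

lemma circle_point_eqI:
  assumes "p \<in> quarter_circle" "0 \<le> \<xi>"
    "1 + snd p - fst p = \<xi> * (sqrt 2 * fst p)" "fst p \<noteq> 0"
  shows "p = circle_point \<xi>"
proof -
  have "0 < fst p" using assms(1,4) by (auto simp: quarter_circle_def)
  then obtain \<eta> where \<eta>: "0 \<le> \<eta>" "p = circle_point \<eta>"
    using quarter_circle_eq_circle_point assms(1) by blast
  have "\<eta> = \<xi>" using circle_point_inverse[OF \<eta>(1)] assms by (simp add: \<eta>(2)[symmetric])
  then show ?thesis using \<eta> by simp
qed

text \<open>The coordinate of the image is compared with \<xi> after clearing the denominators
  \<open>K\<close> of \<open>circle_point\<close> and \<open>D\<close> of \<open>romik\<close>; one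
  polynomial identity per digit remains.\<close>

lemma romik_branch:
  assumes "0 \<le> \<xi>" "d \<in> {1, 2, 3}"
  shows "romik (circle_point (branch d \<xi>)) = circle_point \<xi>"
proof -
  define \<eta> where "\<eta> = branch d \<xi>"
  have \<eta>: "0 \<le> \<eta>" unfolding \<eta>_def using assms(1) by (rule branch_nonneg)
  define K where "K = 1 + sqrt 2 * \<eta> + \<eta>\<^sup>2"
  have K: "0 < K" unfolding K_def using \<eta> by (rule circle_point_denom_pos)
  obtain r :: real where r: "sqrt 2 = r" and s: "r\<^sup>2 - 2 = 0"
    using real_sqrt_pow2[of 2] by simp
  define x y where "x = fst (circle_point \<eta>)" and "y = snd (circle_point \<eta>)"
  have Q: "circle_point \<eta> \<in> quarter_circle" using \<eta> by (rule circle_point_in_quarter_circle)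
  have dig: "has_digit (circle_point \<eta>) d" unfolding \<eta>_def using assms by (rule has_digit_branch)
  define D where "D = 3 - 2 * x - 2 * y"
  have D: "0 < D" using Q romik_denom_pos by (auto simp: D_def x_def y_def quarter_circle_def case_prod_beta)
  have xK: "K * x = 1 + sqrt 2 * \<eta>" "K * y = \<eta> * (sqrt 2 + \<eta>)"
    using K by (simp_all add: x_def y_def circle_point_def K_def)
  define u v where "u = fst (branch_sign d) * (2 - x - 2 * y)"
    and "v = snd (branch_sign d) * (2 - 2 * x - y)"
  have romik_eq: "romik (circle_point \<eta>) = (u / D, v / D)"
    unfolding romik_on_digit[OF Q dig] by (simp add: u_def v_def D_def x_def y_def)
  have KD: "K * D = 1 - sqrt 2 * \<eta> + \<eta>\<^sup>2"
  proof -
    have "K * D = 3 * K - 2 * (K * x) - 2 * (K * y)" by (simp add: D_def algebra_simps)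
    then show ?thesis unfolding xK by (simp add: K_def algebra_simps power2_eq_square)
  qed
  have N: "0 < 1 + sqrt 2 * \<xi>" using assms by (simp add: add_pos_nonneg)
  have Ku: "K * u = fst (branch_sign d) * (2 * K - K * x - 2 * (K * y))"
    and Kv: "K * v = snd (branch_sign d) * (2 * K - 2 * (K * x) - K * y)"
    by (simp_all add: u_def v_def algebra_simps)
  have Ku': "K * u = fst (branch_sign d) * (1 - sqrt 2 * \<eta>)"
    unfolding Ku xK by (simp add: K_def algebra_simps power2_eq_square)
  have Kv': "K * v = snd (branch_sign d) * (\<eta>\<^sup>2 - sqrt 2 * \<eta>)"
    unfolding Kv xK by (simp add: K_def algebra_simps power2_eq_square)
  \<comment> \<open>The coordinate equation for the point (u / D, v / D), multiplied by
    \<open>K * D\<close>; the second conjunct keeps the image away from (0, 1).\<close>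
  have main: "K * D + K * v - K * u = \<xi> * (sqrt 2 * (K * u)) \<and> K * u \<noteq> 0"
  proof -
    consider "d = 1" | "d = 2" | "d = 3" using assms by auto
    then show ?thesis
    proof cases
      case 1
      have e: "\<eta> * (1 + sqrt 2 * \<xi>) - \<xi> = 0" using N by (simp add: \<eta>_def 1 branch_def)
      then have "(1 - sqrt 2 * \<eta>) * (1 + sqrt 2 * \<xi>) = 1" using s unfolding r by algebra
      then have "1 - sqrt 2 * \<eta> \<noteq> 0" by auto
      moreover have "1 - sqrt 2 * \<eta> + \<eta>\<^sup>2 + - 1 * (\<eta>\<^sup>2 - sqrt 2 * \<eta>) - 1 * (1 - sqrt 2 * \<eta>) =
         \<xi> * (sqrt 2 * (1 * (1 - sqrt 2 * \<eta>)))"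
        using s e unfolding r by algebra
      ultimately show ?thesis unfolding KD Ku' Kv' by (simp add: 1 branch_sign_def)
    next
      case 2
      have e: "\<eta> * (1 + sqrt 2 * \<xi>) - (\<xi> + sqrt 2) = 0" using N by (simp add: \<eta>_def 2 branch_def)
      have "(sqrt 2 * \<eta>) * (1 + sqrt 2 * \<xi>) = sqrt 2 * (\<eta> * (1 + sqrt 2 * \<xi>))" by simp
      also have "\<dots> = sqrt 2 * (\<xi> + sqrt 2)" using e by simp
      also have "\<dots> = sqrt 2 * \<xi> + 2" by (simp add: distrib_left)
      finally have f: "(sqrt 2 * \<eta>) * (1 + sqrt 2 * \<xi>) = sqrt 2 * \<xi> + 2" .
      then have "1 - sqrt 2 * \<eta> \<noteq> 0" by auto
      moreover have "1 - sqrt 2 * \<eta> + \<eta>\<^sup>2 + - 1 * (\<eta>\<^sup>2 - sqrt 2 * \<eta>) - - 1 * (1 - sqrt 2 * \<eta>) =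
         \<xi> * (sqrt 2 * (- 1 * (1 - sqrt 2 * \<eta>)))"
        using f by (simp add: algebra_simps)
      ultimately show ?thesis unfolding KD Ku' Kv' by (simp add: 2 branch_sign_def)
    next
      case 3
      have "1 - sqrt 2 * \<eta> = - (1 + sqrt 2 * \<xi>)" by (simp add: \<eta>_def 3 branch_def distrib_left)
      then have "1 - sqrt 2 * \<eta> \<noteq> 0" using N by auto
      moreover have "1 - sqrt 2 * \<eta> + \<eta>\<^sup>2 + 1 * (\<eta>\<^sup>2 - sqrt 2 * \<eta>) - - 1 * (1 - sqrt 2 * \<eta>) =
         \<xi> * (sqrt 2 * (- 1 * (1 - sqrt 2 * \<eta>)))"
        by (simp add: \<eta>_def 3 branch_def power2_eq_square algebra_simps)
      ultimately show ?thesis unfolding KD Ku' Kv' by (simp add: 3 branch_sign_def)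
    qed
  qed
  have "K * (D + v - u) = K * (\<xi> * (sqrt 2 * u))" using main by (simp add: algebra_simps)
  then have "D + v - u = \<xi> * (sqrt 2 * u)" using K by simp
  then have "1 + v / D - u / D = \<xi> * (sqrt 2 * (u / D))"
    using D by (simp add: field_simps)
  moreover have "u / D \<noteq> 0" using main D by auto
  ultimately show ?thesis
    unfolding \<eta>_def[symmetric]
    using circle_point_eqI[OF romik_in_quarter_circle[OF Q] assms(1)] romik_eq by simp
qed


section \<open>Norms of substituted words\<close>

text \<open>The first digit is the outermost branch, because Romik's map strips digits from the
  front.\<close>

definition letter_map :: "letter \<Rightarrow> real \<Rightarrow> real" where
  "letter_map e = foldr branch (Pi_letter e)"

lemma letter_map_simps:
  assumes "0 \<le> \<xi>"
  shows "letter_map La \<xi> = (3 * \<xi> + sqrt 2) / (1 + sqrt 2 * \<xi>)"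
    and "letter_map Lb \<xi> = (\<xi> + sqrt 2) / (1 + sqrt 2 * \<xi>)"
    and "letter_map Lav \<xi> = (\<xi> + sqrt 2) / (3 + sqrt 2 * \<xi>)"
proof -
  have N: "0 < 1 + sqrt 2 * \<xi>" using assms by (simp add: add_pos_nonneg)
  then show "letter_map La \<xi> = (3 * \<xi> + sqrt 2) / (1 + sqrt 2 * \<xi>)"
    by (simp add: letter_map_def branch_def field_simps)
  show "letter_map Lb \<xi> = (\<xi> + sqrt 2) / (1 + sqrt 2 * \<xi>)"
    by (simp add: letter_map_def branch_def)
  show "letter_map Lav \<xi> = (\<xi> + sqrt 2) / (3 + sqrt 2 * \<xi>)"
    by (simp add: letter_map_def branch_def algebra_simps)
qed

lemma sqrt2_bounds: "7/5 \<le> sqrt 2" "sqrt 2 \<le> 3/2"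
  by (rule real_le_rsqrt, simp add: power2_eq_square) (rule real_le_lsqrt, simp_all add: power2_eq_square)

text \<open>Single digits lack such bounds: \<open>branch 1\<close> fixes 0 and
  \<open>branch 3\<close> is unbounded. The blocks 31 and 13 taken as one map are compact in
  range.\<close>

lemma letter_map_bounds:
  assumes "0 \<le> \<xi>"
  shows "1/3 \<le> letter_map e \<xi>" "letter_map e \<xi> \<le> 3"
proof -
  have N: "0 < 1 + sqrt 2 * \<xi>" "0 < 3 + sqrt 2 * \<xi>" using assms by (simp_all add: add_pos_nonneg)
  have b: "7/5 * \<xi> \<le> sqrt 2 * \<xi>" "sqrt 2 * \<xi> \<le> 3/2 * \<xi>"
    using assms sqrt2_bounds by (intro mult_right_mono; simp)+
  show "1/3 \<le> letter_map e \<xi>" using N b assms sqrt2_bounds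
    by (cases e) (simp_all add: letter_map_simps pos_le_divide_eq)
  show "letter_map e \<xi> \<le> 3" using N b assms sqrt2_bounds
    by (cases e) (simp_all add: letter_map_simps pos_divide_le_eq)
qed

text \<open>The determinant \<open>a * c - b * d\<close> is 1 or -1 for every
  \<open>letter_map\<close>, so only the denominators change distances.\<close>

lemma abs_diff_mobius:
  fixes \<xi> \<eta> :: real
  assumes "0 < c + d * \<xi>" "0 < c + d * \<eta>" "a * c - b * d \<in> {1, -1}"
  shows "\<bar>(a * \<xi> + b) / (c + d * \<xi>) - (a * \<eta> + b) / (c + d * \<eta>)\<bar> =
    \<bar>\<xi> - \<eta>\<bar> / ((c + d * \<xi>) * (c + d * \<eta>))"
proof -
  have "(a * \<xi> + b) / (c + d * \<xi>) - (a * \<eta> + b) / (c + d * \<eta>) =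
    ((a * \<xi> + b) * (c + d * \<eta>) - (a * \<eta> + b) * (c + d * \<xi>)) / ((c + d * \<xi>) * (c + d * \<eta>))"
    using assms by (intro diff_frac_eq) auto
  also have "(a * \<xi> + b) * (c + d * \<eta>) - (a * \<eta> + b) * (c + d * \<xi>) = (a * c - b * d) * (\<xi> - \<eta>)"
    by (simp add: algebra_simps)
  finally show ?thesis using assms by (auto simp: abs_mult)
qed

lemma letter_map_contraction:
  assumes "1/3 \<le> \<xi>" "1/3 \<le> \<eta>"
  shows "\<bar>letter_map e \<xi> - letter_map e \<eta>\<bar> \<le> \<bar>\<xi> - \<eta>\<bar> / 2"
proof -
  have bound: "\<bar>\<xi> - \<eta>\<bar> / ((c + sqrt 2 * \<xi>) * (c + sqrt 2 * \<eta>)) \<le> \<bar>\<xi> - \<eta>\<bar> / 2" if "1 \<le> c" for c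
  proof -
    \<comment> \<open>Each denominator is at least 1 + 7/15 = 22/15, and (22/15)^2 = 484/225 exceeds
      2; this gives the factor 1/2.\<close>
    have "7/5 * (1/3) \<le> sqrt 2 * \<xi>" "7/5 * (1/3) \<le> sqrt 2 * \<eta>"
      using assms sqrt2_bounds by (intro mult_mono; simp)+
    then have "22/15 \<le> c + sqrt 2 * \<xi>" "22/15 \<le> c + sqrt 2 * \<eta>" using that by simp_all
    then have "22/15 * (22/15) \<le> (c + sqrt 2 * \<xi>) * (c + sqrt 2 * \<eta>)" by (intro mult_mono) auto
    then show ?thesis by (intro divide_left_mono) auto
  qed
  have N: "0 < c + sqrt 2 * \<xi>" "0 < c + sqrt 2 * \<eta>" if "1 \<le> c" for c
    using assms that by (simp_all add: add_pos_nonneg)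
  have nn: "0 \<le> \<xi>" "0 \<le> \<eta>" using assms by auto
  show ?thesis
  proof (cases e)
    case La
    then show ?thesis
      using abs_diff_mobius[of 1 "sqrt 2" \<xi> \<eta> 3 "sqrt 2"] bound[of 1] N[of 1] nn by (simp add: letter_map_simps)
  next
    case Lb
    then show ?thesis
      using abs_diff_mobius[of 1 "sqrt 2" \<xi> \<eta> 1 "sqrt 2"] bound[of 1] N[of 1] nn by (simp add: letter_map_simps)
  next
    case Lav
    then show ?thesis
      using abs_diff_mobius[of 3 "sqrt 2" \<xi> \<eta> 1 "sqrt 2"] bound[of 3] N[of 3] nn by (simp add: letter_map_simps)
  qed
qed

section \<open>Convergence of the continued fractions attached to letter words\<close>

primrec approx :: "nat \<Rightarrow> letter stream \<Rightarrow> real" where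
  "approx 0 E = 1"
| "approx (Suc n) E = letter_map (shd E) (approx n (stl E))"

definition val :: "letter stream \<Rightarrow> real" where
  "val E = lim (\<lambda>n. approx n E)"

lemma approx_bounds: "1/3 \<le> approx n E" "approx n E \<le> 3"
proof -
  have "1/3 \<le> approx n E \<and> approx n E \<le> 3"
  proof (induction n arbitrary: E)
    case (Suc n)
    have "0 \<le> approx n (stl E)" using Suc[of "stl E"] by linarith
    then show ?case using letter_map_bounds by simp
  qed simp
  then show "1/3 \<le> approx n E" "approx n E \<le> 3" by auto
qed

text \<open>The two truncations share \<open>n\<close> outer letter maps, each halving distances,
  around remainders that lie in [1/3, 3].\<close>

lemma approx_diff: "\<bar>approx n E - approx (n + m) E\<bar> \<le> 3 * (1/2) ^ n"
proof (induction n arbitrary: E)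
  case 0
  show ?case using approx_bounds[of m E] by (simp add: abs_le_iff)
next
  case (Suc n)
  have "\<bar>approx (Suc n) E - approx (Suc n + m) E\<bar> \<le> \<bar>approx n (stl E) - approx (n + m) (stl E)\<bar> / 2"
    using letter_map_contraction[OF approx_bounds(1) approx_bounds(1)] by simp
  also have "\<dots> \<le> 3 * (1/2) ^ Suc n" using Suc[of "stl E"] by simp
  finally show ?case .
qed

lemma approx_tendsto_val: "(\<lambda>n. approx n E) \<longlonglongrightarrow> val E"
proof -
  have "Cauchy (\<lambda>n. approx n E)"
  proof (rule CauchyI')
    fix e :: real assume "0 < e"
    have "(\<lambda>n. 3 * (1/2) ^ n :: real) \<longlonglongrightarrow> 3 * 0"
      by (intro tendsto_mult tendsto_const LIMSEQ_power_zero) simp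
    then have "eventually (\<lambda>n. 3 * (1/2) ^ n < e) sequentially"
      using \<open>0 < e\<close> by (intro order_tendstoD(2)) auto
    then obtain M where M: "\<And>n. M \<le> n \<Longrightarrow> 3 * (1/2) ^ n < e"
      by (auto simp: eventually_sequentially)
    have "dist (approx m E) (approx n E) < e" if "M \<le> m" "m < n" for m n
      using approx_diff[of m E "n - m"] M[of m] that by (simp add: dist_real_def)
    then show "\<exists>M. \<forall>m\<ge>M. \<forall>n>m. dist (approx m E) (approx n E) < e" by blast
  qed
  then show ?thesis
    unfolding val_def using Cauchy_convergent convergent_LIMSEQ_iff by blast
qed

lemma val_bounds: "1/3 \<le> val E" "val E \<le> 3"
  using LIMSEQ_le_const[OF approx_tendsto_val] LIMSEQ_le_const2[OF approx_tendsto_val] approx_bounds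
  by blast+

text \<open>Limit of the recursion for \<open>approx\<close>, where the contraction estimate serves
  as continuity of \<open>letter_map\<close>.\<close>

lemma val_unfold: "val E = letter_map (shd E) (val (stl E))"
proof -
  have "(\<lambda>n. \<bar>approx n (stl E) - val (stl E)\<bar> / 2) \<longlonglongrightarrow> \<bar>val (stl E) - val (stl E)\<bar> / 2"
    by (intro tendsto_intros approx_tendsto_val) simp
  then have "(\<lambda>n. \<bar>approx n (stl E) - val (stl E)\<bar> / 2) \<longlonglongrightarrow> 0" by simp
  then have "(\<lambda>n. approx (Suc n) E - letter_map (shd E) (val (stl E))) \<longlonglongrightarrow> 0"
    by (rule tendsto_0_le[where K = 1], intro always_eventually allI)
      (use letter_map_contraction[OF approx_bounds(1) val_bounds(1)] in simp)
  then have "(\<lambda>n. approx (Suc n) E) \<longlonglongrightarrow> letter_map (shd E) (val (stl E))"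
    by (simp add: LIM_zero_iff)
  then show ?thesis
    using LIMSEQ_Suc[OF approx_tendsto_val] LIMSEQ_unique by blast
qed

section \<open>Existence and uniqueness of the point expanding to a substituted word\<close>

lemma Pi_subst_Stream: "Pi_subst (e ## E) = Pi_letter e @- Pi_subst E"
  by (cases e) (simp_all add: Pi_subst_def)

lemma Pi_subst_unfold: "Pi_subst E = Pi_letter (shd E) @- Pi_subst (stl E)"
  using Pi_subst_Stream[of "shd E" "stl E"] by simp

lemma digit_expansion_Stream:
  "digit_expansion (d ## P) p \<longleftrightarrow>
    p \<in> quarter_circle \<and> has_digit p d \<and> digit_expansion P (romik p)"
proof -
  have *: "(\<forall>n. has_digit ((romik ^^ n) p) ((d ## P) !! n)) \<longleftrightarrow>
    has_digit p d \<and> (\<forall>n. has_digit ((romik ^^ n) (romik p)) (P !! n))"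
    (is "(\<forall>n. ?Q n) \<longleftrightarrow> _")
  proof -
    have "(\<forall>n. ?Q n) \<longleftrightarrow> ?Q 0 \<and> (\<forall>n. ?Q (Suc n))" by (metis not0_implies_Suc)
    then show ?thesis by (simp add: funpow_swap1)
  qed
  show ?thesis unfolding digit_expansion_def * using romik_in_quarter_circle by blast
qed

lemma foldr_branch_nonneg: "0 \<le> \<xi> \<Longrightarrow> 0 \<le> foldr branch ds \<xi>"
  by (induction ds) (simp_all add: branch_nonneg)

text \<open>Counting correct digits up to a bound \<open>N\<close> makes an induction on
  \<open>N\<close> possible for infinite words.\<close>

lemma has_digit_foldr_branch:
  assumes "0 \<le> \<xi>" "set ds \<subseteq> {1, 2, 3}"
    and "\<And>n. n < N \<Longrightarrow> has_digit ((romik ^^ n) (circle_point \<xi>)) (P !! n)"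
    and "n < length ds + N"
  shows "has_digit ((romik ^^ n) (circle_point (foldr branch ds \<xi>))) ((ds @- P) !! n)"
  using assms(2,4)
proof (induction ds arbitrary: n)
  case Nil
  then show ?case using assms(3) by simp
next
  case (Cons d ds)
  have nn: "0 \<le> foldr branch ds \<xi>" and d: "d \<in> {1, 2, 3}"
    using assms(1) Cons by (auto intro: foldr_branch_nonneg)
  show ?case
  proof (cases n)
    case 0
    then show ?thesis using has_digit_branch[OF nn d] by simp
  next
    case (Suc m)
    then show ?thesis using Cons romik_branch[OF nn d] by (simp del: funpow.simps add: funpow_Suc_right)
  qed
qed

lemma set_Pi_letter: "set (Pi_letter e) \<subseteq> {1, 2, 3}"
  by (cases e) auto

lemma digit_expansion_val: "digit_expansion (Pi_subst E) (circle_point (val E))"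
proof -
  have nn: "0 \<le> val E" for E using val_bounds(1)[of E] by linarith
  have "n < N \<Longrightarrow> has_digit ((romik ^^ n) (circle_point (val E))) (Pi_subst E !! n)" for n N E
  proof (induction N arbitrary: n E)
    case (Suc N)
    \<comment> \<open>A letter expands to at least one digit, so \<open>N\<close> correct digits of
      the tail give at least \<open>N + 1\<close> for the word.\<close>
    have "0 < length (Pi_letter (shd E))" by (cases "shd E") auto
    then have "n < length (Pi_letter (shd E)) + N" using Suc.prems by linarith
    from has_digit_foldr_branch[OF nn[of "stl E"] set_Pi_letter Suc.IH[of _ "stl E"] this]
    show ?case by (simp flip: Pi_subst_unfold letter_map_def val_unfold)
  qed simp
  then show ?thesis
    unfolding digit_expansion_def using circle_point_in_quarter_circle[OF nn] by blast
qed

lemma digit_expansion_shift: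
  assumes "digit_expansion (ds @- P) p"
  shows "digit_expansion P ((romik ^^ length ds) p)"
  using assms
proof (induction ds arbitrary: p)
  case (Cons d ds)
  then show ?case by (simp del: funpow.simps add: funpow_Suc_right digit_expansion_Stream)
qed simp

text \<open>Romik's map is injective on the points with a given digit, so the digits in
  \<open>ds\<close> fix the way back from the image step by step.\<close>

lemma digit_expansion_shift_eq:
  assumes "digit_expansion (ds @- P) p" "set ds \<subseteq> {1, 2, 3}" "0 \<le> \<xi>"
    "(romik ^^ length ds) p = circle_point \<xi>"
  shows "p = circle_point (foldr branch ds \<xi>)"
  using assms(1,2,4)
proof (induction ds arbitrary: p)
  case (Cons d ds)
  have nn: "0 \<le> foldr branch ds \<xi>" and d: "d \<in> {1, 2, 3}"
    using assms(3) Cons by (auto intro: foldr_branch_nonneg)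
  have p: "p \<in> quarter_circle" "has_digit p d"
    using Cons.prems(1) by (simp_all add: digit_expansion_Stream)
  have "romik p = circle_point (foldr branch ds \<xi>)"
    using Cons by (simp del: funpow.simps add: funpow_Suc_right digit_expansion_Stream)
  then have "romik p = romik (circle_point (branch d (foldr branch ds \<xi>)))"
    using romik_branch[OF nn d] by simp
  then show ?case
    using romik_inj_on_digit[OF p circle_point_in_quarter_circle[OF branch_nonneg[OF nn]]
        has_digit_branch[OF nn d]] by simp
qed simp

text \<open>Only the point \<open>(0, 1)\<close>, with the digits \<open>333\<dots>\<close>, is excluded.\<close>

lemma digit_expansion_Pi_subst_pos:
  assumes "digit_expansion (Pi_subst E) p"
  obtains \<xi> where "0 \<le> \<xi>" "p = circle_point \<xi>"
proof -
  have p: "p \<in> quarter_circle" using assms by (simp add: digit_expansion_def)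
  have "fst p \<noteq> 0"
  proof
    assume 0: "fst p = 0"
    with p have p01: "p = (0, 1)" by (cases p) (auto simp: quarter_circle_def power2_eq_1_iff)
    \<comment> \<open>The point (0, 1) is fixed by \<open>romik\<close> and admits only the digit 3,
      while every \<open>Pi_letter\<close> contains a 1 or a 2.\<close>
    show False
      using assms unfolding Pi_subst_unfold[of E]
      by (cases "shd E") (auto simp: digit_expansion_Stream p01 romik_def has_digit_def)
  qed
  with p have "0 < fst p" by (auto simp: quarter_circle_def)
  with p show ?thesis using that quarter_circle_eq_circle_point by blast
qed

lemma digit_expansion_Pi_subst_step:
  assumes "0 \<le> \<xi>" "digit_expansion (Pi_subst E) (circle_point \<xi>)"
  obtains \<eta> where "0 \<le> \<eta>" "digit_expansion (Pi_subst (stl E)) (circle_point \<eta>)"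
    "\<xi> = letter_map (shd E) \<eta>"
proof -
  let ?w = "Pi_letter (shd E)"
  have E: "digit_expansion (?w @- Pi_subst (stl E)) (circle_point \<xi>)"
    using assms(2) by (simp flip: Pi_subst_unfold)
  note tail = digit_expansion_shift[OF E]
  then obtain \<eta> where \<eta>: "0 \<le> \<eta>" "(romik ^^ length ?w) (circle_point \<xi>) = circle_point \<eta>"
    by (rule digit_expansion_Pi_subst_pos)
  have "circle_point \<xi> = circle_point (foldr branch ?w \<eta>)"
    using digit_expansion_shift_eq[OF E set_Pi_letter \<eta>] .
  then have "\<xi> = foldr branch ?w \<eta>"
    using circle_point_inj assms(1) foldr_branch_nonneg[OF \<eta>(1)] by blast
  then show ?thesis using that[OF \<eta>(1)] tail \<eta>(2) by (simp add: letter_map_def)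
qed

lemma digit_expansion_unique:
  assumes "0 \<le> \<xi>" "digit_expansion (Pi_subst E) (circle_point \<xi>)"
  shows "\<xi> = val E"
proof -
  have *: "\<bar>\<xi> - val E\<bar> \<le> 3 * (1/2) ^ n"
    if "0 \<le> \<xi>" "digit_expansion (Pi_subst E) (circle_point \<xi>)" for n \<xi> E
    using that
  proof (induction n arbitrary: \<xi> E)
    case 0
    then obtain \<eta> where "0 \<le> \<eta>" "\<xi> = letter_map (shd E) \<eta>"
      by (rule digit_expansion_Pi_subst_step)
    then have "\<xi> \<le> 3" using letter_map_bounds by blast
    then show ?case using val_bounds[of E] 0(1) by (simp add: abs_le_iff)
  next
    case (Suc n)
    obtain \<eta> where \<eta>: "0 \<le> \<eta>" "digit_expansion (Pi_subst (stl E)) (circle_point \<eta>)"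
      "\<xi> = letter_map (shd E) \<eta>"
      using Suc.prems by (rule digit_expansion_Pi_subst_step)
    \<comment> \<open>The contraction estimate requires 1/3 \<le> \<eta>; stripping a second letter
      exhibits \<eta> as a value of a letter map.\<close>
    obtain \<zeta> where "0 \<le> \<zeta>" "\<eta> = letter_map (shd (stl E)) \<zeta>"
      using \<eta>(1,2) by (rule digit_expansion_Pi_subst_step)
    then have "1/3 \<le> \<eta>" using letter_map_bounds by blast
    then have "\<bar>\<xi> - val E\<bar> \<le> \<bar>\<eta> - val (stl E)\<bar> / 2"
      using letter_map_contraction[OF _ val_bounds(1)] by (simp add: \<eta>(3) val_unfold[of E])
    also have "\<dots> \<le> 3 * (1/2) ^ Suc n" using Suc.IH[OF \<eta>(1,2)] by simp
    finally show ?case .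
  qed
  have "(\<lambda>n. 3 * (1/2) ^ n :: real) \<longlonglongrightarrow> 3 * 0"
    by (intro tendsto_mult tendsto_const LIMSEQ_power_zero) simp
  then have "\<bar>\<xi> - val E\<bar> \<le> 3 * 0"
    by (rule LIMSEQ_le_const) (use *[OF assms] in blast)
  then show ?thesis by simp
qed

text \<open>Replaces the dynamics by the real function \<open>val\<close> from here on; in
  particular all norms that occur are finite.\<close>

lemma digit_norm_Pi_subst: "digit_norm (Pi_subst E) = ereal (val E)"
proof -
  have nn: "0 \<le> val E" using val_bounds(1)[of E] by linarith
  have "expansion_point (Pi_subst E) = circle_point (val E)"
    unfolding expansion_point_def
  proof (rule the_equality)
    show "digit_expansion (Pi_subst E) (circle_point (val E))" by (rule digit_expansion_val)
    show "p = circle_point (val E)" if "digit_expansion (Pi_subst E) p" for p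
      using that by (metis digit_expansion_Pi_subst_pos digit_expansion_unique)
  qed
  then show ?thesis
    using circle_point_inverse[OF nn] fst_circle_point_pos[OF nn]
    by (simp add: digit_norm_def case_prod_beta)
qed

text \<open>In the coordinate, \<xi> \<mapsto> 1 / \<xi> is the reflection exchanging x and y. It
  swaps the branches of digits 1 and 3 and commutes with that of 2, hence swaps the maps of 31 and
  13.\<close>

lemma letter_map_vee:
  assumes "0 < \<xi>"
  shows "letter_map (vee_letter e) (1 / \<xi>) = 1 / letter_map e \<xi>"
proof -
  have "(1 / \<xi> * p + q) / (c + sqrt 2 * (1 / \<xi>)) = (p + q * \<xi>) / (c * \<xi> + sqrt 2)" for p q c
  proof -
    have "1 / \<xi> * p + q = (p + q * \<xi>) / \<xi>" "c + sqrt 2 * (1 / \<xi>) = (c * \<xi> + sqrt 2) / \<xi>"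
      using assms by (simp_all add: add_divide_distrib)
    then show ?thesis using assms by simp
  qed
  from this[of 1 "sqrt 2" 1] this[of 1 "sqrt 2" 3] this[of 3 "sqrt 2" 1] show ?thesis
    using assms by (cases e) (simp_all add: letter_map_simps algebra_simps)
qed

text \<open>Exact at every stage, since the seed 1 of \<open>approx\<close> is fixed by
  inversion.\<close>

lemma approx_vee: "approx n (vee E) = 1 / approx n E"
proof (induction n arbitrary: E)
  case (Suc n)
  have "0 < approx n (stl E)" using approx_bounds(1)[of n "stl E"] by linarith
  then show ?case using letter_map_vee Suc[of "stl E"] by (simp add: vee_def)
qed simp

lemma val_vee: "val (vee E) = 1 / val E"
proof -
  have "(\<lambda>n. 1 / approx n E) \<longlonglongrightarrow> 1 / val E"
    using val_bounds(1)[of E] by (intro tendsto_intros approx_tendsto_val) auto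
  then show ?thesis
    using approx_tendsto_val[of "vee E"] LIMSEQ_unique unfolding approx_vee by blast
qed

lemma vee_vee [simp]: "vee (vee E) = E"
proof -
  have "vee_letter (vee_letter x) = x" for x by (cases x) auto
  then show ?thesis by (simp add: vee_def stream.map_comp comp_def stream.map_ident)
qed

section \<open>The order on words produced by jmath\<close>

lemma snth_jmath:
  "jmath X !! k = (if X !! k = La \<and> odd (count_list (stake k X) Lb) then Lav else X !! k)"
  by (simp add: jmath_def)

lemma stream_eqI: "(\<And>n. s !! n = t !! n) \<Longrightarrow> s = t"
  using smap_alt[of id s t] by (simp add: stream.map_id)

lemma jmath_Stream_La: "jmath (La ## X) = La ## jmath X"
proof (rule stream_eqI)
  show "jmath (La ## X) !! n = (La ## jmath X) !! n" for n
    unfolding snth_jmath by (cases n) (simp_all add: snth_jmath)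
qed

text \<open>A leading b flips the parity at all later positions. The restriction to a and b matters:
  \<open>jmath\<close> would leave an \<open>Lav\<close> in place where \<open>vee\<close> changes
  it.\<close>

lemma jmath_Stream_Lb:
  assumes "sset X \<subseteq> {La, Lb}"
  shows "jmath (Lb ## X) = Lb ## vee (jmath X)"
proof (rule stream_eqI)
  fix n
  show "jmath (Lb ## X) !! n = (Lb ## vee (jmath X)) !! n"
  proof (cases n)
    case (Suc m)
    have "X !! m \<in> {La, Lb}" using assms snth_sset by blast
    then show ?thesis unfolding snth_jmath by (auto simp: Suc snth_jmath vee_def)
  qed (simp add: jmath_def)
qed

text \<open>The letter \<open>a\<close> yields larger values than \<open>b\<close>, and \<open>b\<close> reverses the order
  while \<open>\<jmath>\<close> compensates by inverting the norm of the rest.\<close>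

lemma approx_jmath_mono:
  assumes "sset X \<subseteq> {La, Lb}" "sset Y \<subseteq> {La, Lb}"
    and "\<And>k. count_list (stake k X) Lb \<le> count_list (stake k Y) Lb"
  shows "approx n (jmath Y) \<le> approx n (jmath X)"
  using assms
proof (induction n arbitrary: X Y)
  case (Suc n)
  obtain x X' where X: "X = x ## X'" by (cases X)
  obtain y Y' where Y: "Y = y ## Y'" by (cases Y)
  have xy: "x \<in> {La, Lb}" "y \<in> {La, Lb}" and sX: "sset X' \<subseteq> {La, Lb}" and sY: "sset Y' \<subseteq> {La, Lb}"
    using Suc.prems by (auto simp: X Y)
  define \<xi> \<eta> where "\<xi> = approx n (jmath X')" and "\<eta> = approx n (jmath Y')"
  have pos: "0 < \<xi>" "0 < \<eta>"
    using approx_bounds(1)[of n "jmath X'"] approx_bounds(1)[of n "jmath Y'"] by (simp_all add: \<xi>_def \<eta>_def)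
  have N: "0 < 1 + sqrt 2 * \<xi>" "0 < 1 + sqrt 2 * \<eta>" "0 < \<xi> + sqrt 2" "0 < \<eta> + sqrt 2"
    using pos by (simp_all add: add_pos_pos)
  \<comment> \<open>Both formulas are centred at sqrt 2: a leading a gives a value above it, a
    leading b one below it, and each is increasing in the value \<zeta> of the tail before
    \<open>vee\<close>.\<close>
  have La: "approx (Suc n) (jmath (La ## Z)) = sqrt 2 + \<zeta> / (1 + sqrt 2 * \<zeta>)"
    if "\<zeta> = approx n (jmath Z)" for \<zeta> Z
    using that by (simp add: jmath_Stream_La letter_map_def branch_def)
  have Lb: "approx (Suc n) (jmath (Lb ## Z)) = sqrt 2 - 1 / (\<zeta> + sqrt 2)"
    if "sset Z \<subseteq> {La, Lb}" "\<zeta> = approx n (jmath Z)" "0 < \<zeta>" for \<zeta> Z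
  proof -
    have "0 < \<zeta> + sqrt 2" using that by (simp add: add_pos_pos)
    then show ?thesis
      using that by (simp add: jmath_Stream_Lb approx_vee letter_map_simps divide_simps) (simp add: algebra_simps)
  qed
  have le: "\<eta> \<le> \<xi>" if "x = y"
  proof -
    have "count_list (stake k X') Lb \<le> count_list (stake k Y') Lb" for k
      using Suc.prems(3)[of "Suc k"] that by (simp add: X Y split: if_splits)
    then show ?thesis unfolding \<xi>_def \<eta>_def using Suc.IH sX sY by blast
  qed
  \<comment> \<open>Prefixes of length 1 exclude b against a. For a against b the tails need not be
    comparable, and sqrt 2 separates the values.\<close>
  consider "x = La" "y = La" | "x = Lb" "y = Lb" | "x = La" "y = Lb"
    using xy Suc.prems(3)[of 1] by (auto simp: X Y)
  then show ?case
  proof cases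
    case 1
    then have "\<eta> / (1 + sqrt 2 * \<eta>) \<le> \<xi> / (1 + sqrt 2 * \<xi>)"
      using le N by (simp add: divide_simps) (simp add: algebra_simps)
    then show ?thesis unfolding X Y 1 La[OF \<xi>_def] La[OF \<eta>_def] by simp
  next
    case 2
    then have "1 / (\<xi> + sqrt 2) \<le> 1 / (\<eta> + sqrt 2)"
      using le N by (intro divide_left_mono) auto
    then show ?thesis unfolding X Y 2 Lb[OF sX \<xi>_def pos(1)] Lb[OF sY \<eta>_def pos(2)] by simp
  next
    case 3
    have "- (1 / (\<eta> + sqrt 2)) \<le> 0" "0 \<le> \<xi> / (1 + sqrt 2 * \<xi>)" using pos N by auto
    then show ?thesis unfolding X Y 3 La[OF \<xi>_def] Lb[OF sY \<eta>_def pos(2)] by linarith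
  qed
qed simp

lemma val_jmath_mono:
  assumes "sset X \<subseteq> {La, Lb}" "sset Y \<subseteq> {La, Lb}"
    and "\<And>k. count_list (stake k X) Lb \<le> count_list (stake k Y) Lb"
  shows "val (jmath Y) \<le> val (jmath X)"
  using LIMSEQ_le[OF approx_tendsto_val approx_tendsto_val] approx_jmath_mono[OF assms] by blast


section \<open>Christoffel words as mechanical words\<close>

lemma count_list_La_Lb: "set w \<subseteq> {La, Lb} \<Longrightarrow> count_list w La + count_list w Lb = length w"
  by (induction w) auto

lemma count_list_take_mono: "j \<le> k \<Longrightarrow> count_list (take j w) x \<le> count_list (take k w) x"
  by (auto simp: le_iff_add take_add)

text \<open>With k = x + y, lying below the segment means (s + t) y \<le> k t. If y were smaller
  than the floor, the lattice point (x - 1, y + 1) would be on or below the segment, strictly below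
  by coprimality, yet above the path.\<close>

lemma count_list_take_christoffel:
  assumes "0 < s" "coprime s t" "lower_christoffel_of_slope s t w" "k \<le> length w"
  shows "count_list (take k w) Lb = k * t div (s + t)"
proof -
  define x y where "x = count_list (take k w) La" and "y = count_list (take k w) Lb"
  note w = assms(3)[unfolded lower_christoffel_of_slope_def]
  have "set (take k w) \<subseteq> {La, Lb}" using w set_take_subset by fast
  from count_list_La_Lb[OF this] have k: "k = x + y" using assms(4) by (simp add: x_def y_def)
  have path: "(x, y) \<in> path_points w" using assms(4) by (auto simp: path_points_def x_def y_def)
  then have below: "s * y \<le> t * x" using w by blast
  have "k * t < (s + t) * Suc y"
  proof (rule ccontr)
    assume "\<not> k * t < (s + t) * Suc y"
    then have le: "s * Suc y + t \<le> t * x" by (simp add: k algebra_simps)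
    have "0 < x" using le assms(1) by (cases x) auto
    then obtain x' where x': "x = Suc x'" by (cases x) auto
    have le': "s * Suc y \<le> t * x'" using le by (simp add: x')
    have "x \<le> s" using count_list_take_mono[OF assms(4), of w La] w by (simp add: x_def)
    then have "x' < s" by (simp add: x')
    have "s * Suc y \<noteq> t * x'"
    proof
      assume eq: "s * Suc y = t * x'"
      then have "s dvd t * x'" by (metis dvd_triv_left)
      then have "s dvd x'" using assms(2) by (simp add: coprime_dvd_mult_right_iff)
      then have "x' = 0" using \<open>x' < s\<close> by (auto dest: dvd_imp_le)
      then show False using eq assms(1) by simp
    qed
    with le' have "s * Suc y < t * x'" by simp
    then obtain y' where "(x', y') \<in> path_points w" "\<not> y' < Suc y"
      using w \<open>x' < s\<close> by (meson less_imp_le)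
    then obtain k' where k': "x' = count_list (take k' w) La" "y' = count_list (take k' w) Lb"
      by (auto simp: path_points_def)
    \<comment> \<open>The path is monotone: up to step \<open>k\<close> its height is at most
      \<open>y\<close>, and after step \<open>k\<close> it never returns to column
      \<open>x'\<close>.\<close>
    show False
    proof (cases "k' \<le> k")
      case True
      then show ?thesis using count_list_take_mono[of k' k w Lb] k' \<open>\<not> y' < Suc y\<close> by (simp add: y_def)
    next
      case False
      then show ?thesis using count_list_take_mono[of k k' w La] k' x' by (simp add: x_def)
    qed
  qed
  moreover have "(s + t) * y \<le> k * t" using below by (simp add: k algebra_simps)
  ultimately show ?thesis unfolding y_def[symmetric] by (intro div_nat_eqI[symmetric]) (simp_all add: mult.commute)
qed

section \<open>Mechanical words and the number of b in their blocks\<close>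

definition height :: "nat \<Rightarrow> nat \<Rightarrow> int \<Rightarrow> int" where
  "height t n i = i * int t div int n"

text \<open>A two-sided coding of the line of slope t / n: \<open>div\<close> rounds down for
  negative arguments too, so \<open>height\<close> is a floor on both sides of 0.\<close>

definition mechanical :: "nat \<Rightarrow> nat \<Rightarrow> int \<Rightarrow> letter" where
  "mechanical t n i = (if height t n (i + 1) = height t n i then La else Lb)"

definition right_word :: "nat \<Rightarrow> nat \<Rightarrow> int \<Rightarrow> letter stream" where
  "right_word t n m = smap (\<lambda>k. mechanical t n (m + int k)) nats"

definition left_word :: "nat \<Rightarrow> nat \<Rightarrow> int \<Rightarrow> letter stream" where
  "left_word t n m = smap (\<lambda>k. mechanical t n (m - 1 - int k)) nats"

lemma snth_right_word: "right_word t n m !! k = mechanical t n (m + int k)"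
  by (simp add: right_word_def)

lemma snth_left_word: "left_word t n m !! k = mechanical t n (m - 1 - int k)"
  by (simp add: left_word_def)

lemma sset_right_word: "sset (right_word t n m) \<subseteq> {La, Lb}"
  by (auto simp: right_word_def mechanical_def stream.set_map)

lemma sset_left_word: "sset (left_word t n m) \<subseteq> {La, Lb}"
  by (auto simp: left_word_def mechanical_def stream.set_map)

lemma div_add_ge:
  fixes a b n :: int
  assumes "0 < n"
  shows "a div n + b div n \<le> (a + b) div n"
proof -
  have "n * (a div n) \<le> a" "n * (b div n) \<le> b" using assms
    using minus_mod_eq_mult_div[of a n] minus_mod_eq_mult_div[of b n] pos_mod_sign[of n a] pos_mod_sign[of n b]
    by linarith+
  then have "(a div n + b div n) * n \<le> a + b" by (simp add: algebra_simps)
  then have "(a div n + b div n) * n div n \<le> (a + b) div n" using assms by (intro zdiv_mono1)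
  then show ?thesis using assms by simp
qed

text \<open>Superadditivity of the floor, the source of both extremal properties: blocks starting at
  0 have the fewest b, blocks ending at 0 the most.\<close>

lemma height_add_ge: "0 < n \<Longrightarrow> height t n i + height t n j \<le> height t n (i + j)"
  unfolding height_def by (simp add: distrib_right div_add_ge)

lemma height_0 [simp]: "height t n 0 = 0"
  by (simp add: height_def)

text \<open>As t \<le> n, the line rises by at most 1 per step, so the floor increases by 0 or 1 and
  \<open>mechanical\<close> records the increment.\<close>

lemma height_Suc:
  assumes "0 < n" "t \<le> n"
  shows "height t n (i + 1) = height t n i + (if mechanical t n i = Lb then 1 else 0)"
proof -
  have "height t n i \<le> height t n (i + 1)"
    unfolding height_def using assms by (intro zdiv_mono1 mult_right_mono) auto
  moreover have "height t n (i + 1) \<le> (i * int t + int n) div int n"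
    unfolding height_def using assms by (intro zdiv_mono1) (auto simp: algebra_simps)
  moreover have "(i * int t + int n) div int n = height t n i + 1"
    using assms by (simp add: height_def)
  ultimately show ?thesis by (auto simp: mechanical_def)
qed

lemma count_right_word:
  assumes "0 < n" "t \<le> n"
  shows "int (count_list (stake k (right_word t n m)) Lb) = height t n (m + int k) - height t n m"
proof (induction k)
  case (Suc k)
  have "height t n (m + int (Suc k)) = height t n (m + int k + 1)" by (simp add: algebra_simps)
  with Suc show ?case
    using height_Suc[OF assms, of "m + int k"] by (simp add: stake_Suc snth_right_word del: stake.simps)
qed simp

lemma count_left_word:
  assumes "0 < n" "t \<le> n"
  shows "int (count_list (stake k (left_word t n m)) Lb) = height t n m - height t n (m - int k)"
proof (induction k)
  case (Suc k)
  have "height t n (m - int (Suc k)) = height t n (m - 1 - int k)" by (simp add: algebra_simps)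
  with Suc show ?case
    using height_Suc[OF assms, of "m - 1 - int k"] by (simp add: stake_Suc snth_left_word del: stake.simps)
qed simp

text \<open>Every block of length \<open>k\<close> contains at least \<open>\<lfloor>k t / n\<rfloor>\<close> and at most \<open>\<lceil>k t / n\<rceil>\<close> letters
  \<open>b\<close>; the two central words attain these extremes simultaneously for all prefixes.\<close>

lemma mechanical_word_bounds:
  assumes "0 < n" "t \<le> n" "X \<in> range (right_word t n) \<union> range (left_word t n)"
  shows "val (jmath X) \<le> val (jmath (right_word t n 0))"
    and "val (jmath (left_word t n 0)) \<le> val (jmath X)"
proof -
  note counts = count_right_word[OF assms(1,2)] count_left_word[OF assms(1,2)]
  have X: "sset X \<subseteq> {La, Lb}" using assms(3) sset_right_word sset_left_word by blast
  have "int (count_list (stake k (right_word t n 0)) Lb) \<le> int (count_list (stake k X) Lb)" for k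
  proof -
    \<comment> \<open>The first inequality treats the left words, the second the right
      words.\<close>
    have "height t n (int k) + height t n (m - int k) \<le> height t n m" for m
      using height_add_ge[OF assms(1), of t "int k" "m - int k"] by simp
    moreover have "height t n (int k) + height t n m \<le> height t n (m + int k)" for m
      using height_add_ge[OF assms(1), of t "int k" m] by (simp add: add.commute)
    ultimately show ?thesis using assms(3) by (auto simp: counts le_diff_eq)
  qed
  then show "val (jmath X) \<le> val (jmath (right_word t n 0))"
    by (intro val_jmath_mono X sset_right_word) simp
  have "int (count_list (stake k X) Lb) \<le> int (count_list (stake k (left_word t n 0)) Lb)" for k
  proof -
    \<comment> \<open>The prefix of length \<open>k\<close> of the central left word has
      \<open>- height t n (- int k)\<close> letters b, the ceiling of k t / n. Here the first
      inequality treats right words, the second left words.\<close>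
    have "height t n (m + int k) + height t n (- int k) \<le> height t n m" for m
      using height_add_ge[OF assms(1), of t "m + int k" "- int k"] by simp
    moreover have "height t n m + height t n (- int k) \<le> height t n (m - int k)" for m
      using height_add_ge[OF assms(1), of t m "- int k"] by simp
    ultimately show ?thesis using assms(3) by (auto simp: counts algebra_simps)
  qed
  then show "val (jmath (left_word t n 0)) \<le> val (jmath X)"
    by (intro val_jmath_mono X sset_left_word) simp
qed

section \<open>Identification with the periodic words of a Christoffel word\<close>

lemma mechanical_periodic:
  assumes "0 < n"
  shows "mechanical t n (i + q * int n) = mechanical t n i"
proof -
  have "height t n (j + q * int n) = height t n j + q * int t" for j
  proof -
    have "(j + q * int n) * int t = j * int t + (q * int t) * int n" by (simp add: algebra_simps)
    then show ?thesis using assms by (simp add: height_def)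
  qed
  from this[of i] this[of "i + 1"] show ?thesis by (simp add: mechanical_def algebra_simps)
qed

lemma snth_cycle:
  assumes "w \<noteq> []"
  shows "cycle w !! k = w ! (k mod length w)"
proof -
  have "cycle w !! k = shd (sdrop k (cycle w))" by simp
  also have "\<dots> = hd (rotate (k mod length w) w)"
    unfolding sdrop_cycle[OF assms] by simp
  finally show ?thesis using assms by (simp add: hd_rotate_conv_nth)
qed

lemma christoffel_nth:
  assumes "0 < s" "coprime s t" "lower_christoffel_of_slope s t w" "k < length w"
  shows "w ! k = mechanical t (s + t) (int k)"
proof -
  have h: "int (count_list (take j w) Lb) = height t (s + t) (int j)" if "j \<le> length w" for j
    using count_list_take_christoffel[OF assms(1-3) that] by (simp add: height_def zdiv_int)
  have "count_list (take (Suc k) w) Lb = count_list (take k w) Lb + (if w ! k = Lb then 1 else 0)"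
    using assms(4) by (simp add: take_Suc_conv_app_nth)
  then have "height t (s + t) (int k + 1) = height t (s + t) (int k) + (if w ! k = Lb then 1 else 0)"
    using h[of k] h[of "Suc k"] assms(4) by (auto simp: add.commute split: if_splits)
  moreover have "w ! k \<in> {La, Lb}"
    using assms(3,4) unfolding lower_christoffel_of_slope_def by (meson nth_mem subsetD)
  ultimately show ?thesis by (auto simp: mechanical_def)
qed

lemma christoffel_length:
  assumes "lower_christoffel_of_slope s t w"
  shows "length w = s + t"
  using count_list_La_Lb[of w] assms by (simp add: lower_christoffel_of_slope_def)

lemma cycle_christoffel:
  assumes "0 < s" "coprime s t" "lower_christoffel_of_slope s t w"
  shows "cycle w = right_word t (s + t) 0" "cycle (rev w) = left_word t (s + t) 0"
proof -
  note len = christoffel_length[OF assms(3)]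
  then have ne: "w \<noteq> []" using assms(1) by auto
  have lt: "k mod (s + t) < length w" for k using len assms(1) by simp
  have k: "int k = int (k mod (s + t)) + int (k div (s + t)) * int (s + t)" for k
    by (simp only: mod_div_mult_eq flip: of_nat_mult of_nat_add)
  show "cycle w = right_word t (s + t) 0"
  proof (rule stream_eqI)
    show "cycle w !! k = right_word t (s + t) 0 !! k" for k
      using christoffel_nth[OF assms lt[of k]] mechanical_periodic[of "s + t" t "int (k mod (s + t))"] k[of k] assms(1)
      by (simp add: snth_cycle[OF ne] snth_right_word len)
  qed
  show "cycle (rev w) = left_word t (s + t) 0"
  proof (rule stream_eqI)
    fix k
    \<comment> \<open>The index in \<open>w\<close> of letter \<open>k\<close> of the repeated
      reverse; it is congruent to -1 - k modulo s + t.\<close>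
    let ?r = "s + t - 1 - k mod (s + t)"
    have r: "?r < length w" using len assms(1) by simp
    have "int ?r = int (s + t) - 1 - int (k mod (s + t))" using lt[of k] len by linarith
    then have "int ?r = - 1 - int k + (int (k div (s + t)) + 1) * int (s + t)"
      using k[of k] by (simp add: algebra_simps)
    then have "mechanical t (s + t) (int ?r) = mechanical t (s + t) (- 1 - int k)"
      using mechanical_periodic[of "s + t" t] assms(1) by simp
    then show "cycle (rev w) !! k = left_word t (s + t) 0 !! k"
      using christoffel_nth[OF assms r] lt[of k] snth_cycle[of "rev w" k] ne
      by (simp add: snth_left_word len rev_nth)
  qed
qed


section \<open>Sections of the doubly infinite word\<close>

text \<open>Two-sided form of \<open>jmath\<close>: for a letter a at position \<open>i\<close>, the
  parity of the number of b between it and the base point 0 is that of \<open>height t n i\<close>,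
  on either side.\<close>

definition twisted :: "nat \<Rightarrow> nat \<Rightarrow> int \<Rightarrow> letter" where
  "twisted t n i = (if mechanical t n i = Lb then Lb else if odd (height t n i) then Lav else La)"

text \<open>Counting b from \<open>m\<close> instead of 0 changes the count by
  \<open>height t n m\<close>; an odd change amounts to one global \<open>vee\<close>.\<close>

lemma snth_jmath_right_word:
  assumes "0 < n" "t \<le> n"
  shows "twisted t n (m + int k) =
    (if even (height t n m) then jmath (right_word t n m) else vee (jmath (right_word t n m))) !! k"
proof -
  have "odd (count_list (stake k (right_word t n m)) Lb) \<longleftrightarrow>
      odd (height t n (m + int k) - height t n m)"
    by (simp flip: count_right_word[OF assms])
  moreover have "mechanical t n (m + int k) \<in> {La, Lb}" by (simp add: mechanical_def)
  ultimately show ?thesis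
    by (auto simp: twisted_def snth_jmath snth_right_word vee_def)
qed

lemma snth_jmath_left_word:
  assumes "0 < n" "t \<le> n"
  shows "twisted t n (m - 1 - int k) =
    (if even (height t n m) then jmath (left_word t n m) else vee (jmath (left_word t n m))) !! k"
proof -
  have "odd (count_list (stake k (left_word t n m)) Lb) \<longleftrightarrow>
      odd (height t n m - height t n (m - int k))"
    by (simp flip: count_left_word[OF assms])
  moreover have "mechanical t n (m - 1 - int k) \<in> {La, Lb}" by (simp add: mechanical_def)
  \<comment> \<open>On the left, \<open>jmath\<close> counts the b strictly between the letter and
    the cut, which involves the height one position further right than in \<open>twisted\<close>.
    For a letter a the two heights agree.\<close>
  moreover have "height t n (m - int k) = height t n (m - 1 - int k)"
    if "mechanical t n (m - 1 - int k) = La"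
    using height_Suc[OF assms, of "m - 1 - int k"] that by (simp add: algebra_simps)
  ultimately show ?thesis
    by (auto simp: twisted_def snth_jmath snth_left_word vee_def)
qed

lemma glue_eq_iff:
  "glue E F = B \<longleftrightarrow> (\<forall>k. F !! k = B (int k)) \<and> (\<forall>k. E !! k = B (- 1 - int k))"
proof safe
  fix i assume "\<forall>k. F !! k = B (int k)" "\<forall>k. E !! k = B (- 1 - int k)"
  then show "glue E F = B" by (auto simp: glue_def fun_eq_iff)
qed (simp_all add: glue_def)

text \<open>A section is a shift by some \<open>m\<close>, and the parity of
  \<open>height t n m\<close> decides for both halves at once whether \<open>vee\<close> is
  applied.\<close>

lemma sections_twisted:
  assumes "0 < n" "t \<le> n" "(E, F) \<in> sections (abs_biword (twisted t n))"
  obtains m where "E = jmath (left_word t n m)" "F = jmath (right_word t n m)"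
  | m where "E = vee (jmath (left_word t n m))" "F = vee (jmath (right_word t n m))"
proof -
  have "shift_equiv (twisted t n) (glue E F)"
    using assms(3) by (simp add: sections_def biword_of_section_def flip: biword.abs_eq_iff)
  then obtain m where m: "\<And>i. glue E F i = twisted t n (i + m)"
    unfolding shift_equiv_def by blast
  then have "glue E F = (\<lambda>i. twisted t n (i + m))" by blast
  then have "F !! k = twisted t n (m + int k)" "E !! k = twisted t n (m - 1 - int k)" for k
    unfolding glue_eq_iff by (simp_all add: algebra_simps)
  note this[unfolded snth_jmath_right_word[OF assms(1,2)] snth_jmath_left_word[OF assms(1,2)]]
  then have "F = (if even (height t n m) then jmath (right_word t n m) else vee (jmath (right_word t n m)))"
    "E = (if even (height t n m) then jmath (left_word t n m) else vee (jmath (left_word t n m)))"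
    by (auto intro!: stream_eqI)
  then show ?thesis using that by (cases "even (height t n m)") auto
qed

text \<open>The left half enters through its \<open>vee\<close>, hence inverted: a large value asks
  for small \<open>val E\<close> and large \<open>val F\<close>.\<close>

lemma L_section_eq: "L_section E F = ereal ((1 / val E + val F) / sqrt 2)"
  by (simp add: L_section_def digit_norm_Pi_subst val_vee)

theorem theorem4p7:
  fixes w :: "letter list"
  assumes "lower_christoffel w" and "\<not> trivial_christoffel w"
  shows "L_biword (Bword w) = L_section (Eword (rev w)) (Eword w)"
proof -
  obtain s t where st: "0 < s" "coprime s t" "lower_christoffel_of_slope s t w"
    using assms unfolding lower_christoffel_def by blast
  define n where "n = s + t"
  have n: "0 < n" "t \<le> n" using st by (simp_all add: n_def)
  have F: "Eword w = jmath (right_word t n 0)" and E: "Eword (rev w) = jmath (left_word t n 0)"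
    using cycle_christoffel[OF st] by (simp_all add: Eword_def n_def)
  have "glue (Eword (rev w)) (Eword w) = twisted t n"
    unfolding glue_eq_iff E F
    using snth_jmath_right_word[OF n, of 0] snth_jmath_left_word[OF n, of 0] by simp
  then have B: "Bword w = abs_biword (twisted t n)"
    by (simp add: Bword_def biword_of_section_def)
  let ?M = "L_section (Eword (rev w)) (Eword w)"
  have pos: "0 < val X" for X using val_bounds(1)[of X] by linarith
  \<comment> \<open>Both words range over left and right words alike, since in the dual section the
    right half is the inverted one and the roles are exchanged.\<close>
  have le: "1 / val (jmath X) + val (jmath Y) \<le> 1 / val (Eword (rev w)) + val (Eword w)"
    if "X \<in> range (right_word t n) \<union> range (left_word t n)"
      "Y \<in> range (right_word t n) \<union> range (left_word t n)" for X Y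
    using mechanical_word_bounds(2)[OF n that(1)] mechanical_word_bounds(1)[OF n that(2)] pos
    unfolding E F by (intro add_mono divide_left_mono) auto
  have "max (L_section G H) (L_section (vee G) (vee H)) \<le> ?M"
    if "(G, H) \<in> sections (Bword w)" for G H
  proof -
    have main: "max (L_section (jmath (left_word t n m)) (jmath (right_word t n m)))
      (L_section (vee (jmath (left_word t n m))) (vee (jmath (right_word t n m)))) \<le> ?M" for m
      using le[of "left_word t n m" "right_word t n m"] le[of "right_word t n m" "left_word t n m"]
      by (auto simp: L_section_eq val_vee add.commute intro!: divide_right_mono)
    from n that[unfolded B] show ?thesis
    proof (cases rule: sections_twisted)
      case (1 m)
      then show ?thesis using main by simp
    next
      \<comment> \<open>By involutivity of \<open>vee\<close>, this section and its dual merely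
        exchange the arguments of \<open>max\<close>.\<close>
      case (2 m)
      then show ?thesis using main by (simp add: max.commute)
    qed
  qed
  then have "L_biword (Bword w) \<le> ?M"
    unfolding L_biword_def by (intro SUP_least) auto
  moreover have "(Eword (rev w), Eword w) \<in> sections (Bword w)"
    by (simp add: sections_def Bword_def)
  then have "?M \<le> L_biword (Bword w)"
    unfolding L_biword_def by (rule SUP_upper2) simp
  ultimately show ?thesis by (rule antisym)
qed

end
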